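(* Let $X$ be a $\sigma$-compact locally compact Hausdorff space, and let $A$ be a non-empty closed subset of $X$. If $d\in \mathrm{Met}(A)$ is a proper metric, then there exists a proper metric $D\in \mathrm{Met}(X)$ with $D|_{A^{2}}=d$.
   Context: For a topological space $X$, $\mathrm{Met}(X)$ denotes the set of all metrics on $X$ (with values in $[0,\infty)$) that generate the given topology of $X$. A subset $A$ of $X$ carries the subspace topology. A metric $d$ on $X$ is proper if all bounded closed subsets of $(X,d)$ are compact. A space is $\sigma$-compact if it is a countable union of compact subspaces, and locally compact if every point has a compact neighborhood.
   Formalization: X is additionally assumed metrizable; without this the claim fails (X = [0,1]^ℝ, A a single point, d = 0, where Met(X) is empty), and the conclusion itself forces X to be metrizable. *)

theory Defs
  imports "HOL-Analysis.Analysis"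
begin

definition sigma_compact_space :: "'a topology \<Rightarrow> bool" where
  "sigma_compact_space X \<longleftrightarrow>
     (\<exists>\<K>. countable \<K> \<and> (\<forall>K\<in>\<K>. compactin X K) \<and> \<Union>\<K> = topspace X)"

(* Metrics are total functions here, as in the locale Metric_space, which asks for symmetry
   and nonnegativity on the whole type. Only the values on topspace X matter: any metric on
   topspace X can be extended by 0 to meet this requirement. *)
definition Met :: "'a topology \<Rightarrow> ('a \<Rightarrow> 'a \<Rightarrow> real) set" where
  "Met X = {d. Metric_space (topspace X) d \<and> Metric_space.mtopology (topspace X) d = X}"

definition proper_metric :: "'a set \<Rightarrow> ('a \<Rightarrow> 'a \<Rightarrow> real) \<Rightarrow> bool" where
  "proper_metric M d \<longleftrightarrow>
     Metric_space M d \<and>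
     (\<forall>S. closedin (Metric_space.mtopology M d) S \<and> Metric_space.mbounded M d S
        \<longrightarrow> compactin (Metric_space.mtopology M d) S)"

end

(*
  Let s be a metric on X, compatible with the topology, such that s dominates d on A.  Then
    D(x,y) = min (s(x,y), inf {s(x,a) + d(a,b) + s(b,y) | a, b in A})
  is a metric with D <= s that extends d.  Let u = d(a0,.) and let h : X -> [0,oo) be a proper
  continuous extension of u.  If moreover |h(x) - h(y)| <= s(x,y), then h is also 1-Lipschitz
  for D, so that D-bounded sets lie in the compact sets {h <= r}; this gives at once that D
  induces the topology of X and that D is proper.

  For h take the maximum of a Tietze extension of u and of inf_a (u(a) + |p(x) - p(a)|), where
  p is any proper function on X.  For s start from any metric e of X.  Choose L_k >= 1 with
  d <= 1/(k+1) + L_k e on the compact set {h <= k} of A, and put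
  t = min (1, inf_k (1/(k+1) + L_k e)): a bounded metric with d <= (1 + 2r(r+1)) t on {h <= r},
  because d <= 2r there.  With the weight w = 1 + 2(h+1)(h+2) the metric
    s(x,y) = |w(x) - w(y)| + min (w(x), w(y)) t(x,y)
  dominates d: the second term does so when h(x) and h(y) differ by at most 1, and the first
  one otherwise.
*)
theory Submission
  imports Defs
begin

section \<open>Infima and suprema of Lipschitz families\<close>

lemma abs_INF_diff_le:
  fixes f g :: "'i \<Rightarrow> real"
  assumes "I \<noteq> {}" "bdd_below (f ` I)" "bdd_below (g ` I)"
    and le: "\<And>i. i \<in> I \<Longrightarrow> \<bar>f i - g i\<bar> \<le> c"
  shows "\<bar>(INF i\<in>I. f i) - (INF i\<in>I. g i)\<bar> \<le> c"
proof -
  have "(INF i\<in>I. f i) - c \<le> (INF i\<in>I. g i)"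
  proof (rule cINF_greatest[OF assms(1)])
    fix i assume i: "i \<in> I"
    show "(INF i\<in>I. f i) - c \<le> g i"
      using cINF_lower[OF assms(2) i] le[OF i] by linarith
  qed
  moreover have "(INF i\<in>I. g i) - c \<le> (INF i\<in>I. f i)"
  proof (rule cINF_greatest[OF assms(1)])
    fix i assume i: "i \<in> I"
    show "(INF i\<in>I. g i) - c \<le> f i"
      using cINF_lower[OF assms(3) i] le[OF i] by linarith
  qed
  ultimately show ?thesis by linarith
qed

lemma abs_SUP_diff_le:
  fixes f g :: "'i \<Rightarrow> real"
  assumes "I \<noteq> {}" "bdd_above (f ` I)" "bdd_above (g ` I)"
    and le: "\<And>i. i \<in> I \<Longrightarrow> \<bar>f i - g i\<bar> \<le> c"
  shows "\<bar>(SUP i\<in>I. f i) - (SUP i\<in>I. g i)\<bar> \<le> c"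
proof -
  have "(SUP i\<in>I. f i) \<le> (SUP i\<in>I. g i) + c"
  proof (rule cSUP_least[OF assms(1)])
    fix i assume i: "i \<in> I"
    show "f i \<le> (SUP i\<in>I. g i) + c"
      using cSUP_upper[OF i assms(3)] le[OF i] by linarith
  qed
  moreover have "(SUP i\<in>I. g i) \<le> (SUP i\<in>I. f i) + c"
  proof (rule cSUP_least[OF assms(1)])
    fix i assume i: "i \<in> I"
    show "g i \<le> (SUP i\<in>I. f i) + c"
      using cSUP_upper[OF i assms(2)] le[OF i] by linarith
  qed
  ultimately show ?thesis by linarith
qed

lemma (in Metric_space) continuous_map_nonexpansive:
  assumes "\<And>x y. \<lbrakk>x \<in> M; y \<in> M\<rbrakk> \<Longrightarrow> \<bar>f x - f y\<bar> \<le> d x y"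
  shows "continuous_map mtopology euclideanreal f"
proof -
  have "continuous_map mtopology Met_TC.mtopology f"
    unfolding metric_continuous_map[OF Met_TC.Metric_space_axioms]
    using assms by (force simp: dist_real_def)
  then show ?thesis by simp
qed

section \<open>Proper functions\<close>

text \<open>Each compact piece \<open>C n\<close> gets a bump that is positive on it, vanishes off
  the compact \<open>V n\<close> and has height at most \<open>(1/2)^n\<close>. The supremum
  \<open>z\<close> of the bumps is positive everywhere, and a lower bound on \<open>z\<close> leaves
  only finitely many \<open>V n\<close>, so \<open>1/z\<close> is proper.\<close>

lemma (in Metric_space) proper_function_exists:
  assumes "sigma_compact_space mtopology" "locally_compact_space mtopology"
  obtains p where "continuous_map mtopology euclideanreal p"
    and "\<And>r. compactin mtopology {x \<in> M. p x \<le> r}"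
proof -
  obtain \<K> where \<K>: "countable \<K>" "\<And>K. K \<in> \<K> \<Longrightarrow> compactin mtopology K" "\<Union>\<K> = M"
    using assms(1) unfolding sigma_compact_space_def by auto
  \<comment> \<open>The added empty set lets the family be enumerated by a sequence even if
    \<open>\<K>\<close> is empty.\<close>
  define C where "C = from_nat_into (insert {} \<K>)"
  have rangeC: "range C = insert {} \<K>"
    unfolding C_def by (rule range_from_nat_into) (use \<K> in auto)
  have "compactin mtopology (C n)" for n
    using rangeC \<K>(2) by (metis compactin_empty insertE rangeI)
  then have "\<forall>n. \<exists>U V. openin mtopology U \<and> compactin mtopology V \<and> closedin mtopology V \<and> C n \<subseteq> U \<and> U \<subseteq> V"
    using assms(2) locally_compact_space_compact_closed_compact Hausdorff_space_mtopology by blast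
  then obtain U V where UV: "\<And>n. openin mtopology (U n)" "\<And>n. compactin mtopology (V n)"
      "\<And>n. closedin mtopology (V n)" "\<And>n. C n \<subseteq> U n" "\<And>n. U n \<subseteq> V n"
    by metis
  \<comment> \<open>\<open>f n x\<close> is the minimum of \<open>(1/2)^n\<close> and the distance from \<open>x\<close> to \<open>M - U n\<close>; the
    index \<open>None\<close> supplies the cap and keeps the infimum nonempty when \<open>U n = M\<close>.\<close>
  define I where "I n = insert None (Some ` (M - U n))" for n
  define \<phi> where "\<phi> n x i = (case i of None \<Rightarrow> (1/2)^n | Some y \<Rightarrow> d x y)" for n :: nat and x i
  define f where "f n x = (INF i\<in>I n. \<phi> n x i)" for n x
  have \<phi>0: "0 \<le> \<phi> n x i" for n x i by (auto simp: \<phi>_def split: option.split)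
  have bdd: "bdd_below (\<phi> n x ` I n)" for n x
    by (rule bdd_belowI[of _ 0]) (use \<phi>0 in auto)
  have f0: "0 \<le> f n x" for n x
    unfolding f_def by (rule cINF_greatest) (auto simp: I_def \<phi>0)
  have f1: "f n x \<le> (1/2)^n" for n x
    unfolding f_def using cINF_lower[OF bdd, of None n x] by (simp add: I_def \<phi>_def)
  have f_lip: "\<bar>f n x - f n y\<bar> \<le> d x y" if "x \<in> M" "y \<in> M" for n x y
    unfolding f_def
  proof (rule abs_INF_diff_le[OF _ bdd bdd])
    fix i assume "i \<in> I n"
    then consider "i = None" | a where "i = Some a" "a \<in> M" by (auto simp: I_def)
    then show "\<bar>\<phi> n x i - \<phi> n y i\<bar> \<le> d x y"
    proof cases
      case 2
      then show ?thesis
        using triangle[OF that, of a] triangle[OF that(2,1), of a] commute[of x y]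
        by (simp add: \<phi>_def)
    qed (simp add: \<phi>_def)
  qed (auto simp: I_def)
  have f_out: "f n x = 0" if "x \<in> M - V n" for n x
  proof -
    have "Some x \<in> I n" using that UV(5) by (auto simp: I_def)
    from cINF_lower[OF bdd this, of x] have "f n x \<le> 0" using that by (simp add: f_def \<phi>_def)
    with f0 show ?thesis by (meson order_antisym)
  qed
  have f_pos: "f n x > 0" if x: "x \<in> C n" for n x
  proof -
    obtain r where r: "r > 0" "mball x r \<subseteq> U n" and xM: "x \<in> M"
      using UV(1)[of n] UV(4)[of n] x unfolding openin_mtopology by blast
    have "min ((1/2)^n) r \<le> f n x"
      unfolding f_def
    proof (rule cINF_greatest)
      fix i assume "i \<in> I n"
      then show "min ((1/2)^n) r \<le> \<phi> n x i"
        using r xM by (fastforce simp: I_def \<phi>_def min_le_iff_disj not_less[symmetric])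
    qed (auto simp: I_def)
    then show ?thesis using r by (smt (verit) zero_less_power half_gt_zero zero_less_one)
  qed
  define z where "z x = (SUP n. f n x)" for x
  have f_le1: "f n x \<le> 1" for n x
    using f1[of n x] power_le_one[of "1/2::real" n] by simp
  have bdda: "bdd_above (range (\<lambda>n. f n x))" for x
    using f_le1 by (auto intro: bdd_aboveI[of _ 1])
  have fz: "f n x \<le> z x" for n x
    unfolding z_def by (rule cSUP_upper[OF _ bdda]) simp
  have "continuous_map mtopology euclideanreal z"
    unfolding z_def by (intro continuous_map_nonexpansive abs_SUP_diff_le[OF _ bdda bdda]) (auto intro: f_lip)
  moreover have z_pos: "z x > 0" if xM: "x \<in> M" for x
  proof -
    obtain K where "K \<in> \<K>" "x \<in> K" using \<K>(3) xM by blast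
    then obtain n where "x \<in> C n" using rangeC by (metis insertI2 imageE)
    then show ?thesis using f_pos fz by (meson less_le_trans)
  qed
  ultimately have cont: "continuous_map mtopology euclideanreal (\<lambda>x. inverse (z x))"
    by (intro continuous_map_real_inverse) force+
  have "compactin mtopology {x \<in> M. inverse (z x) \<le> r}" for r
  proof -
    \<comment> \<open>Using \<open>\<bar>r\<bar> + 1\<close> keeps the denominator positive for
      every sign of \<open>r\<close>. On the sublevel set \<open>z\<close> exceeds
      \<open>(1/2)^N\<close>, hence so does some \<open>f n\<close>; its height bound forces
      \<open>n < N\<close> and its support puts the point in \<open>V n\<close>.\<close>
    obtain N where N: "(1/2)^N < 1 / (\<bar>r\<bar> + 1)"
      using real_arch_pow_inv[of "1 / (\<bar>r\<bar> + 1)" "1/2"] by (auto simp: add_nonneg_pos)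
    have sub: "{x \<in> M. inverse (z x) \<le> r} \<subseteq> (\<Union>n<N. V n)"
    proof
      fix x assume x: "x \<in> {x \<in> M. inverse (z x) \<le> r}"
      then have zx: "z x > 0" using z_pos by blast
      have "inverse (z x) < \<bar>r\<bar> + 1" using x by auto
      then have "1 / (\<bar>r\<bar> + 1) < z x"
        using zx by (simp add: field_simps)
      then have "(1/2)^N < z x" using N by linarith
      then obtain n where n: "(1/2)^N < f n x"
        unfolding z_def using less_cSUP_iff[OF _ bdda] by blast
      have "n < N"
      proof (rule ccontr)
        assume "\<not> n < N"
        then have "(1/2::real)^n \<le> (1/2)^N" by (intro power_decreasing) auto
        then show False using n f1[of n x] by linarith
      qed
      moreover have "x \<in> V n"
        using f_out[of x n] n x by (smt (verit) DiffI mem_Collect_eq zero_le_power half_gt_zero zero_less_one)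
      ultimately show "x \<in> (\<Union>n<N. V n)" by blast
    qed
    have "compactin mtopology (\<Union>n<N. V n)"
      using UV(2) by (intro compactin_Union) auto
    moreover have "closedin mtopology {x \<in> M. inverse (z x) \<in> {..r}}"
      using closedin_continuous_map_preimage[OF cont, of "{..r}"] by simp
    ultimately show ?thesis
      using closed_compactin[OF _ sub] by auto
  qed
  with cont that show ?thesis by blast
qed

text \<open>A Tietze extension may be negative and need not be proper. The maximum with
  \<open>\<psi> (p x)\<close>, which is nonnegative and stays below \<open>u\<close> on
  \<open>A\<close>, repairs both defects without changing the values on \<open>A\<close>.\<close>

lemma proper_extension_exists:
  fixes u :: "'a \<Rightarrow> real"
  assumes "normal_space X" "closedin X A" "A \<noteq> {}"
    and u: "continuous_map (subtopology X A) euclideanreal u" "\<And>a. a \<in> A \<Longrightarrow> 0 \<le> u a"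
      "\<And>r. compactin X {a \<in> A. u a \<le> r}"
    and p: "continuous_map X euclideanreal p" "\<And>r. compactin X {x \<in> topspace X. p x \<le> r}"
  obtains h where "continuous_map X euclideanreal h" "\<And>a. a \<in> A \<Longrightarrow> h a = u a"
    "\<And>x. 0 \<le> h x" "\<And>r. compactin X {x \<in> topspace X. h x \<le> r}"
proof -
  have AX: "A \<subseteq> topspace X" using assms(2) closedin_subset by blast
  obtain g where g: "continuous_map X euclideanreal g" "\<And>a. a \<in> A \<Longrightarrow> g a = u a"
    using assms(1,2) u(1) unfolding normal_space_iff_Tietze by metis
  define \<psi> where "\<psi> r = (INF a\<in>A. u a + \<bar>r - p a\<bar>)" for r
  have bdd: "bdd_below ((\<lambda>a. u a + \<bar>r - p a\<bar>) ` A)" for r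
    by (rule bdd_belowI[of _ 0]) (use u(2) in force)
  have \<psi>0: "0 \<le> \<psi> r" for r
    unfolding \<psi>_def using u(2) by (intro cINF_greatest[OF assms(3)]) force
  have "\<bar>\<psi> r - \<psi> s\<bar> \<le> dist r s" for r s
    unfolding \<psi>_def by (rule abs_INF_diff_le[OF assms(3) bdd bdd]) (auto simp: dist_real_def)
  then have "continuous_map euclideanreal euclideanreal \<psi>"
    using Met_TC.continuous_map_nonexpansive[of \<psi>] by simp
  then have cont\<psi>: "continuous_map X euclideanreal (\<lambda>x. \<psi> (p x))"
    using continuous_map_compose[OF p(1)] unfolding o_def by blast
  have \<psi>u: "\<psi> (p a) \<le> u a" if "a \<in> A" for a
    unfolding \<psi>_def using cINF_lower[OF bdd that, of "p a"] by simp
  define h where "h x = max (g x) (\<psi> (p x))" for x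
  have conth: "continuous_map X euclideanreal h"
    unfolding h_def by (intro continuous_map_real_max g cont\<psi>)
  have "compactin X {x \<in> topspace X. h x \<le> r}" for r
  proof -
    \<comment> \<open>The infimum \<open>\<psi>\<close> need not be attained, hence the slack of 1:
      a near-minimiser \<open>a\<close> lies in this compact set, where \<open>p\<close> is bounded,
      and \<open>p x\<close> differs from \<open>p a\<close> by less than
      \<open>r + 1\<close>.\<close>
    let ?C = "{a \<in> A. u a \<le> r + 1}"
    have "compactin euclideanreal (p ` ?C)"
      using image_compactin[OF u(3) p(1)] .
    then have "bounded (p ` ?C)" by (simp add: compact_imp_bounded)
    then obtain B where B: "\<And>a. a \<in> ?C \<Longrightarrow> \<bar>p a\<bar> \<le> B"
      unfolding bounded_real by auto
    have sub: "{x \<in> topspace X. h x \<le> r} \<subseteq> {x \<in> topspace X. p x \<le> B + r + 1}"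
    proof clarify
      fix x assume "x \<in> topspace X" "h x \<le> r"
      then have "\<psi> (p x) < r + 1" by (simp add: h_def)
      then obtain a where a: "a \<in> A" "u a + \<bar>p x - p a\<bar> < r + 1"
        unfolding \<psi>_def using cINF_less_iff[OF assms(3) bdd] by blast
      then have "\<bar>p a\<bar> \<le> B" by (intro B) auto
      then show "p x \<le> B + r + 1" using a u(2)[OF a(1)] by linarith
    qed
    have "closedin X {x \<in> topspace X. h x \<in> {..r}}"
      using closedin_continuous_map_preimage[OF conth, of "{..r}"] by simp
    then show ?thesis using closed_compactin[OF p(2) sub] by simp
  qed
  moreover have "h a = u a" if "a \<in> A" for a
    using g(2)[OF that] \<psi>u[OF that] by (simp add: h_def)
  moreover have "0 \<le> h x" for x using \<psi>0[of "p x"] by (simp add: h_def)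
  ultimately show ?thesis using conth that by blast
qed

section \<open>A metric on the whole space dominating the given one\<close>

text \<open>The metric \<open>t\<close> is a concave function of \<open>d\<close>, the infimum of 1
  and of affine functions whose intercepts tend to 0. Concavity gives the triangle inequality, the
  small intercepts give continuity and a zero diagonal, and slopes of at least 1 keep
  \<open>t\<close> above \<open>min 1 d\<close>, so that points are separated. The last conclusion
  is the lower-bound rule of the infimum.\<close>

lemma (in Metric_space) concave_gauge_metric:
  fixes L :: "nat \<Rightarrow> real"
  assumes L: "\<And>k. 1 \<le> L k"
  obtains t where "Metric_space M t"
    "continuous_map mtopology (Metric_space.mtopology M t) id"
    "\<And>x y. t x y \<le> 1"
    "\<And>x y c. \<lbrakk>c \<le> 1; \<And>k. c \<le> 1 / Suc k + L k * d x y\<rbrakk> \<Longrightarrow> c \<le> t x y"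
proof -
  define T where "T k x y = 1 / Suc k + L k * d x y" for k x y
  define t where "t x y = min 1 (INF k. T k x y)" for x y
  have Ld: "d x y \<le> L k * d x y" for k x y
    using L[of k] mult_right_mono[of 1 "L k" "d x y"] by simp
  have Td: "d x y \<le> T k x y" for k x y
    unfolding T_def by (rule order_trans[OF Ld[of x y k]]) simp
  have T0: "0 \<le> T k x y" for k x y
    using Td[of x y k] nonneg[of x y] by linarith
  have bdd: "bdd_below (range (\<lambda>k. T k x y))" for x y
    by (rule bdd_belowI[of _ 0]) (use T0 in auto)
  have t_le: "t x y \<le> T k x y" for k x y
    unfolding t_def using cINF_lower[OF bdd, of k x y] by simp
  have t_ge: "c \<le> t x y" if "c \<le> 1" "\<And>k. c \<le> T k x y" for c x y
    unfolding t_def using that by (auto intro: cINF_greatest)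
  have t1: "t x y \<le> 1" for x y by (simp add: t_def)
  have small: "t x y < \<epsilon>" if "1 / Suc k < \<epsilon> / 2" "d x y < \<epsilon> / (2 * L k)" for x y k \<epsilon>
  proof -
    have "L k * d x y < \<epsilon> / 2" using that(2) L[of k] by (simp add: field_simps)
    then show ?thesis using that(1) t_le[of x y k] unfolding T_def by linarith
  qed
  have tri: "t x z \<le> t x y + t y z" if "x \<in> M" "y \<in> M" "z \<in> M" for x y z
  proof -
    have t0: "0 \<le> t x y" "0 \<le> t y z" by (auto intro!: t_ge T0)
    have *: "t x z \<le> T k x y + T l y z" for k l
    proof -
      \<comment> \<open>An infimum of affine functions with nonnegative intercepts is subadditive: use the
        flatter of the two.\<close>
      define m where "m = (if L k \<le> L l then k else l)"
      have m: "L m \<le> L k" "L m \<le> L l" "1 / Suc m \<le> 1 / Suc k + 1 / Suc l"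
        by (auto simp: m_def)
      have "t x z \<le> 1 / Suc m + L m * d x z" using t_le T_def by metis
      also have "L m * d x z \<le> L m * d x y + L m * d y z"
        using triangle[OF that] L[of m] by (simp flip: distrib_left)
      also have "L m * d x y \<le> L k * d x y" by (rule mult_right_mono) (use m in auto)
      also have "L m * d y z \<le> L l * d y z" by (rule mult_right_mono) (use m in auto)
      finally show ?thesis using m(3) unfolding T_def by linarith
    qed
    \<comment> \<open>The bound for pairs of indices passes to the infima one at a time, first over
      \<open>k\<close> and then over \<open>l\<close>; the cap 1 is the other case of each use of
      \<open>t_ge\<close>.\<close>
    have "t x z - t y z \<le> t x y"
    proof (rule t_ge)
      show "t x z - t y z \<le> 1" using t1[of x z] t0 by linarith
      fix k
      have "t x z - T k x y \<le> t y z"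
      proof (rule t_ge)
        show "t x z - T k x y \<le> 1" using t1[of x z] T0[of k x y] by linarith
        show "t x z - T k x y \<le> T l y z" for l using *[of k l] by linarith
      qed
      then show "t x z - t y z \<le> T k x y" by linarith
    qed
    then show ?thesis by linarith
  qed
  have met: "Metric_space M t"
  proof
    show "0 \<le> t x y" for x y by (auto intro!: t_ge T0)
    show "t x y = t y x" for x y by (simp add: t_def T_def commute)
    fix x y assume xy: "x \<in> M" "y \<in> M"
    show "t x y = 0 \<longleftrightarrow> x = y"
    proof
      assume "t x y = 0"
      moreover have "min 1 (d x y) \<le> t x y"
        by (rule t_ge) (auto intro: order_trans[OF _ Td])
      ultimately have "d x y = 0" using nonneg[of x y] by linarith
      then show "x = y" using xy by simp
    next
      assume "x = y"
      have "t x x < \<epsilon>" if "\<epsilon> > 0" for \<epsilon>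
      proof -
        obtain k where "1 / Suc k < \<epsilon> / 2"
          using reals_Archimedean[of "\<epsilon>/2"] \<open>\<epsilon> > 0\<close> by (auto simp: inverse_eq_divide)
        then show ?thesis
          using small[of k \<epsilon> x x] L[of k] xy \<open>x = y\<close> that by simp
      qed
      then have "t x x \<le> 0" by (meson less_irrefl not_le)
      moreover have "0 \<le> t x x" by (auto intro!: t_ge T0)
      ultimately show "t x y = 0" using \<open>x = y\<close> by simp
    qed
  qed (rule tri)
  have "continuous_map mtopology (Metric_space.mtopology M t) id"
    unfolding metric_continuous_map[OF met]
  proof (intro conjI ballI allI impI)
    fix x and \<epsilon> :: real assume "x \<in> M" "\<epsilon> > 0"
    obtain k where "1 / Suc k < \<epsilon> / 2"
      using reals_Archimedean[of "\<epsilon>/2"] \<open>\<epsilon> > 0\<close> by (auto simp: inverse_eq_divide)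
    then show "\<exists>\<delta>>0. \<forall>y. y \<in> M \<and> d x y < \<delta> \<longrightarrow> t (id x) (id y) < \<epsilon>"
      using small L[of k] \<open>\<epsilon> > 0\<close> by (intro exI[of _ "\<epsilon> / (2 * L k)"]) auto
  qed auto
  then show ?thesis
    using that[OF met _ t1] t_ge unfolding T_def by blast
qed

text \<open>The term \<open>\<bar>w x - w y\<bar>\<close> pays for a detour through a point of smaller weight, because
  \<open>d \<le> 1\<close>.\<close>

lemma (in Metric_space) weighted_metric:
  fixes w :: "'a \<Rightarrow> real"
  assumes w: "\<And>x. 0 < w x" and d1: "\<And>x y. d x y \<le> 1"
  shows "Metric_space M (\<lambda>x y. \<bar>w x - w y\<bar> + min (w x) (w y) * d x y)"
proof
  fix x y z
  show "0 \<le> \<bar>w x - w y\<bar> + min (w x) (w y) * d x y"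
    using w[of x] w[of y] by (intro add_nonneg_nonneg mult_nonneg_nonneg) auto
  show "\<bar>w x - w y\<bar> + min (w x) (w y) * d x y = \<bar>w y - w x\<bar> + min (w y) (w x) * d y x"
    by (simp add: commute min.commute abs_minus_commute)
  assume xy: "x \<in> M" "y \<in> M"
  show "\<bar>w x - w y\<bar> + min (w x) (w y) * d x y = 0 \<longleftrightarrow> x = y"
  proof
    assume eq: "\<bar>w x - w y\<bar> + min (w x) (w y) * d x y = 0"
    have "0 \<le> min (w x) (w y) * d x y" 
      using w[of x] w[of y] by (intro mult_nonneg_nonneg) auto
    then have "min (w x) (w y) * d x y = 0" using eq by linarith
    moreover have "min (w x) (w y) \<noteq> 0" using w[of x] w[of y] by linarith
    ultimately show "x = y" using xy by simp
  qed (use xy in auto)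
  assume z: "z \<in> M"
  define m where "m = min (w x) (w z)"
  define q where "q = d x y + d y z"
  have m0: "0 < m" using w by (simp add: m_def)
  have q: "d x z \<le> q" "q \<le> 2" "0 \<le> q"
    using triangle[OF xy z] d1[of x y] d1[of y z] by (simp_all add: q_def)
  have mq: "m * d x z \<le> m * q" using q m0 by simp
  show "\<bar>w x - w z\<bar> + min (w x) (w z) * d x z
    \<le> \<bar>w x - w y\<bar> + min (w x) (w y) * d x y + (\<bar>w y - w z\<bar> + min (w y) (w z) * d y z)"
  proof (cases "m \<le> w y")
    case True
    then have "m * d x y \<le> min (w x) (w y) * d x y" "m * d y z \<le> min (w y) (w z) * d y z"
      by (auto intro!: mult_right_mono simp: m_def)
    then show ?thesis using mq by (simp add: q_def m_def[symmetric] distrib_left)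
  next
    case False
    \<comment> \<open>Here \<open>y\<close> is lighter than both ends. The two weight differences
      exceed \<open>\<bar>w x - w z\<bar>\<close> by exactly \<open>2 * (m - w y)\<close>, which
      pays for lowering the factor of \<open>q\<close> from \<open>m\<close> to \<open>w y\<close>,
      as \<open>q \<le> 2\<close>.\<close>
    have "(m - w y) * q \<le> (m - w y) * 2" using False q by (intro mult_left_mono) auto
    then have "m * d x z \<le> w y * q + 2 * (m - w y)" using mq by (simp add: algebra_simps)
    moreover have "\<bar>w x - w y\<bar> + \<bar>w y - w z\<bar> = \<bar>w x - w z\<bar> + 2 * (m - w y)"
      using False by (auto simp: m_def min_def split: if_splits)
    moreover have "min (w x) (w y) = w y" "min (w y) (w z) = w y" using False by (auto simp: m_def)
    ultimately show ?thesis by (simp add: q_def m_def[symmetric] distrib_left)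
  qed
qed

section \<open>Gluing and properness\<close>

text \<open>Besides the direct distance, \<open>D\<close> allows one detour: a leg to
  \<open>A\<close>, a jump in \<open>A\<close> measured by \<open>d\<close>, and a leg out.
  Domination makes an \<open>s\<close>-leg between points of \<open>A\<close> no cheaper than a
  jump, so \<open>d\<close> survives on \<open>A\<close> and one detour suffices. Closedness of
  \<open>A\<close> keeps distinct points apart. The last conclusion serves to bound \<open>D\<close>
  from below.\<close>

lemma amalgamated_metric:
  fixes s d :: "'a \<Rightarrow> 'a \<Rightarrow> real"
  assumes s: "Metric_space M s" and d: "Metric_space A d" and "A \<noteq> {}"
    and clo: "closedin (Metric_space.mtopology M s) A"
    and ds: "\<And>a b. \<lbrakk>a \<in> A; b \<in> A\<rbrakk> \<Longrightarrow> d a b \<le> s a b"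
  obtains D where "Metric_space M D" "\<And>x y. D x y \<le> s x y"
    "\<And>a b. \<lbrakk>a \<in> A; b \<in> A\<rbrakk> \<Longrightarrow> D a b = d a b"
    "\<And>x y c. \<lbrakk>c \<le> s x y; \<And>a b. \<lbrakk>a \<in> A; b \<in> A\<rbrakk> \<Longrightarrow> c \<le> s x a + d a b + s b y\<rbrakk> \<Longrightarrow> c \<le> D x y"
proof -
  interpret S: Metric_space M s by fact
  interpret A: Metric_space A d by fact
  have AM: "A \<subseteq> M" using closedin_subset[OF clo] by simp
  define J where "J x y p = s x (fst p) + d (fst p) (snd p) + s (snd p) y" for x y p
  define D where "D x y = min (s x y) (INF p\<in>A \<times> A. J x y p)" for x y
  have bdd: "bdd_below (J x y ` (A \<times> A))" for x y
    by (rule bdd_belowI[of _ 0]) (auto simp: J_def)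
  have Ds: "D x y \<le> s x y" for x y by (simp add: D_def)
  have DJ: "D x y \<le> s x a + d a b + s b y" if "a \<in> A" "b \<in> A" for x y a b
    using cINF_lower[OF bdd, of "(a, b)" x y] that by (auto simp: D_def J_def)
  have D_ge: "c \<le> D x y" if "c \<le> s x y" "\<And>a b. \<lbrakk>a \<in> A; b \<in> A\<rbrakk> \<Longrightarrow> c \<le> s x a + d a b + s b y" for x y c
    using that assms(3) by (auto simp: D_def J_def intro!: cINF_greatest)
  have D0: "0 \<le> D x y" for x y by (rule D_ge) auto
  have comm: "D x y \<le> D y x" for x y
  proof (rule D_ge)
    show "D x y \<le> s y x" using Ds S.commute by metis
    show "D x y \<le> s y a + d a b + s b x" if "a \<in> A" "b \<in> A" for a b
      using DJ[OF that(2,1), of x y] S.commute[of x b] S.commute[of a y] A.commute[of b a] by linarith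
  qed
  have DA: "D a b = d a b" if ab: "a \<in> A" "b \<in> A" for a b
  proof (rule antisym)
    show "D a b \<le> d a b" using DJ[OF ab, of a b] ab AM by (auto simp: subset_iff)
    show "d a b \<le> D a b"
    proof (rule D_ge)
      fix a' b' assume ab': "a' \<in> A" "b' \<in> A"
      show "d a b \<le> s a a' + d a' b' + s b' b"
        using A.triangle[OF ab(1) ab'(1) ab(2)] A.triangle[OF ab' ab(2)]
          ds[OF ab(1) ab'(1)] ds[OF ab'(2) ab(2)] by linarith
    qed (rule ds[OF ab])
  qed
  have near: "x \<in> A" if x: "x \<in> M" and a: "\<And>\<epsilon>. \<epsilon> > 0 \<Longrightarrow> \<exists>a\<in>A. s x a < \<epsilon>" for x
  proof (rule ccontr)
    assume "x \<notin> A"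
    then obtain r where r: "r > 0" "S.mball x r \<subseteq> M - A"
      using clo x unfolding closedin_def S.openin_mtopology by auto
    from a[OF r(1)] obtain a where "a \<in> A" "s x a < r" by blast
    then have "a \<in> S.mball x r" using x AM by auto
    then show False using r(2) \<open>a \<in> A\<close> by blast
  qed
  have "Metric_space M D"
  proof
    show "D x y = D y x" for x y using comm by (meson order_antisym)
    fix x y z assume xy: "x \<in> M" "y \<in> M"
    show "D x y = 0 \<longleftrightarrow> x = y"
    proof
      assume "x = y"
      then show "D x y = 0" using Ds[of x y] D0[of x y] xy by simp
    next
      assume D: "D x y = 0"
      show "x = y"
      proof (rule ccontr)
        assume "x \<noteq> y"
        then have pos: "s x y > 0" using xy S.mdist_pos_less by blast
        \<comment> \<open>As \<open>s x y\<close> is positive, only detours can make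
          \<open>D x y\<close> vanish. Their short outer legs put \<open>x\<close> and
          \<open>y\<close> into the closed set \<open>A\<close>, where \<open>D\<close> is the
          metric \<open>d\<close>.\<close>
        have ex: "\<exists>a\<in>A. \<exists>b\<in>A. s x a + d a b + s b y < \<epsilon>" if "\<epsilon> > 0" for \<epsilon>
        proof (rule ccontr)
          assume "\<not> ?thesis"
          then have "min (s x y) \<epsilon> \<le> D x y" by (intro D_ge) (auto simp: not_less min.coboundedI2)
          then show False using D pos that by simp
        qed
        have "x \<in> A"
        proof (rule near[OF xy(1)])
          fix \<epsilon> :: real assume "\<epsilon> > 0"
          from ex[OF this] obtain a b where "a \<in> A" "s x a + d a b + s b y < \<epsilon>" by blast
          then show "\<exists>a\<in>A. s x a < \<epsilon>"
            using A.nonneg[of a b] S.nonneg[of b y] by (intro bexI[of _ a]) linarith+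
        qed
        moreover have "y \<in> A"
        proof (rule near[OF xy(2)])
          fix \<epsilon> :: real assume "\<epsilon> > 0"
          from ex[OF this] obtain a b where "b \<in> A" "s x a + d a b + s b y < \<epsilon>" by blast
          then show "\<exists>a\<in>A. s y a < \<epsilon>"
            using A.nonneg[of a b] S.nonneg[of x a] S.commute[of b y] by (intro bexI[of _ b]) linarith+
        qed
        ultimately show False using DA D \<open>x \<noteq> y\<close> by auto
      qed
    qed
    assume z: "z \<in> M"
    \<comment> \<open>Nested uses of \<open>D_ge\<close> reduce the triangle inequality to four
      cases: each of the two pieces is direct or a detour.\<close>
    have "D x z - D y z \<le> D x y"
    proof (rule D_ge)
      have "D x z - s x y \<le> D y z"
      proof (rule D_ge)
        show "D x z - s x y \<le> s y z" using Ds[of x z] S.triangle[OF xy z] by linarith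
        show "D x z - s x y \<le> s y a + d a b + s b z" if "a \<in> A" "b \<in> A" for a b
          using DJ[OF that, of x z] S.triangle[OF xy, of a] that AM by force
      qed
      then show "D x z - D y z \<le> s x y" by linarith
      fix a b assume ab: "a \<in> A" "b \<in> A"
      have "D x z - (s x a + d a b + s b y) \<le> D y z"
      proof (rule D_ge)
        have "s b z \<le> s b y + s y z" using S.triangle[of b y z] ab AM xy z by blast
        then show "D x z - (s x a + d a b + s b y) \<le> s y z" using DJ[OF ab, of x z] by linarith
        fix a' b' assume ab': "a' \<in> A" "b' \<in> A"
        \<comment> \<open>Two detours merge into one: the legs from \<open>b\<close> to
          \<open>y\<close> and on to \<open>a'\<close> cost at least \<open>s b a'\<close>, hence at
          least the jump \<open>d b a'\<close>.\<close>
        have "s b a' \<le> s b y + s y a'" using S.triangle[of b y a'] ab ab' AM xy by blast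
        moreover have "d a b' \<le> d a b + d b a' + d a' b'"
          using A.triangle[of a b b'] A.triangle[of b a' b'] ab ab' by linarith
        ultimately show "D x z - (s x a + d a b + s b y) \<le> s y a' + d a' b' + s b' z"
          using DJ[OF ab(1) ab'(2), of x z] ds[OF ab(2) ab'(1)] by linarith
      qed
      then show "D x z - D y z \<le> s x a + d a b + s b y" by linarith
    qed
    then show "D x z \<le> D x y + D y z" by linarith
  qed (rule D0)
  then show ?thesis using that Ds DA D_ge by blast
qed

text \<open>A coarser Hausdorff topology agrees with the original one on compact sets. Since
  \<open>h\<close> is 1-Lipschitz for \<open>D\<close>, the open unit \<open>D\<close>-ball around
  \<open>x\<close> lies in the compact set where \<open>h\<close> is at most \<open>h x + 1\<close>,
  so this local agreement suffices.\<close>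

lemma proper_metric_topology:
  assumes D: "Metric_space (topspace X) D"
    and cont: "continuous_map X (Metric_space.mtopology (topspace X) D) id"
    and h: "\<And>r. compactin X {x \<in> topspace X. h x \<le> r}"
    and hD: "\<And>x y. \<lbrakk>x \<in> topspace X; y \<in> topspace X\<rbrakk> \<Longrightarrow> \<bar>h x - h y\<bar> \<le> D x y"
  shows "Metric_space.mtopology (topspace X) D = X" and "proper_metric (topspace X) D"
proof -
  interpret D: Metric_space "topspace X" D by fact
  have le: "openin X U" if "openin D.mtopology U" for U
  proof -
    have "{x \<in> topspace X. id x \<in> U} = U" using D.openin_mtopology that by auto
    then show ?thesis using openin_continuous_map_preimage[OF cont that] by simp
  qed
  have ge: "openin D.mtopology U" if U: "openin X U" for U
    unfolding D.openin_mtopology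
  proof (intro conjI allI impI)
    show UX: "U \<subseteq> topspace X" using U openin_subset by blast
    fix x assume x: "x \<in> U"
    define K where "K = {y \<in> topspace X. h y \<le> h x + 1}"
    \<comment> \<open>The part of \<open>K\<close> outside \<open>U\<close> is compact for
      \<open>X\<close>, hence for \<open>D\<close>, hence \<open>D\<close>-closed, so some
      \<open>D\<close>-ball around \<open>x\<close> misses it. Capping the radius at 1 keeps the
      ball inside \<open>K\<close>.\<close>
    have "compactin X (K \<inter> (topspace X - U))"
      using U h by (intro compact_Int_closedin) (auto simp: K_def)
    moreover have "id ` (K \<inter> (topspace X - U)) = K - U" by (auto simp: K_def)
    ultimately have "compactin D.mtopology (K - U)"
      using image_compactin[OF _ cont] by metis
    then have "closedin D.mtopology (K - U)"
      using D.Hausdorff_space_mtopology compactin_imp_closedin by blast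
    then obtain r where r: "r > 0" "D.mball x r \<subseteq> topspace X - (K - U)"
      using x UX unfolding closedin_def D.openin_mtopology by auto
    have "D.mball x (min r 1) \<subseteq> U"
    proof
      fix y assume y: "y \<in> D.mball x (min r 1)"
      then have "y \<in> K" using hD[of x y] by (auto simp: K_def)
      then show "y \<in> U" using r(2) y by auto
    qed
    then show "\<exists>r>0. D.mball x r \<subseteq> U" using r(1) by (intro exI[of _ "min r 1"]) auto
  qed
  show top: "D.mtopology = X" unfolding topology_eq using le ge by blast
  show "proper_metric (topspace X) D"
    unfolding proper_metric_def top
  proof (intro conjI allI impI D)
    fix S assume S: "closedin X S \<and> D.mbounded S"
    then obtain x B where "S \<subseteq> D.mcball x B" unfolding D.mbounded_def by blast
    then have "S \<subseteq> {y \<in> topspace X. h y \<le> h x + B}" using hD by (force simp: subset_iff)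
    then show "compactin X S" using closed_compactin[OF h] S by blast
  qed
qed

section \<open>Continuity of the identity into a metric, and comparison of two metrics on a compact
  set\<close>

lemma (in Metric_space) continuous_map_id_to_metric:
  assumes "topspace X = M"
  shows "continuous_map X mtopology id \<longleftrightarrow>
    (\<forall>x\<in>M. \<forall>\<epsilon>>0. \<exists>U. openin X U \<and> x \<in> U \<and> (\<forall>y\<in>U. d x y < \<epsilon>))"
proof -
  have "(\<forall>y\<in>U. y \<in> mball x \<epsilon>) \<longleftrightarrow> (\<forall>y\<in>U. d x y < \<epsilon>)" if "openin X U" "x \<in> U" for x \<epsilon> U
    using openin_subset[OF that(1)] that(2) assms by auto
  then show ?thesis unfolding continuous_map_to_metric assms id_def by meson
qed

lemma continuous_weighted_metric:
  fixes w :: "'a \<Rightarrow> real"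
  defines "s t \<equiv> \<lambda>x y. \<bar>w x - w y\<bar> + min (w x) (w y) * t x y"
  assumes t: "Metric_space (topspace X) t" and s: "Metric_space (topspace X) (s t)"
    and w: "continuous_map X euclideanreal w" "\<And>x. 0 < w x"
    and cont: "continuous_map X (Metric_space.mtopology (topspace X) t) id"
  shows "continuous_map X (Metric_space.mtopology (topspace X) (s t)) id"
  unfolding Metric_space.continuous_map_id_to_metric[OF s refl]
proof (intro ballI allI impI)
  interpret T: Metric_space "topspace X" t by fact
  fix x and \<epsilon> :: real assume x: "x \<in> topspace X" and \<epsilon>: "\<epsilon> > 0"
  \<comment> \<open>The factor of \<open>t x y\<close> is at most \<open>w x\<close>, so this bound
    on \<open>t x y\<close> keeps the second summand below half of
    \<open>\<epsilon>\<close>.\<close>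
  have "\<epsilon> / (2 * w x) > 0" using \<epsilon> w(2)[of x] by simp
  with cont[unfolded T.continuous_map_id_to_metric[OF refl]] x
  have "\<exists>U. openin X U \<and> x \<in> U \<and> (\<forall>y\<in>U. t x y < \<epsilon> / (2 * w x))" by (elim ballE allE impE) auto
  then obtain U where U: "openin X U" "x \<in> U" "\<And>y. y \<in> U \<Longrightarrow> t x y < \<epsilon> / (2 * w x)" by auto
  define V where "V = {y \<in> topspace X. w y \<in> ball (w x) (\<epsilon> / 2)}"
  have "openin X V" unfolding V_def by (rule openin_continuous_map_preimage[OF w(1)]) simp
  moreover have "s t x y < \<epsilon>" if "y \<in> U \<inter> V" for y
  proof -
    have "min (w x) (w y) * t x y \<le> w x * t x y" by (rule mult_right_mono) auto
    also have "\<dots> < \<epsilon> / 2" using U(3)[of y] that w(2)[of x] by (simp add: field_simps)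
    finally show ?thesis using that by (simp add: s_def V_def dist_real_def)
  qed
  ultimately show "\<exists>U. openin X U \<and> x \<in> U \<and> (\<forall>y\<in>U. s t x y < \<epsilon>)"
    using U(1,2) x \<epsilon> by (intro exI[of _ "U \<inter> V"]) (auto simp: V_def)
qed

text \<open>On the compact \<open>K\<close> the identity from \<open>e\<close> to \<open>d\<close>
  is uniformly continuous, so pairs closer than some \<open>\<delta>\<close> cost at most
  \<open>\<epsilon>\<close>. For the other pairs the slope \<open>B / \<delta>\<close> suffices,
  with \<open>B\<close> a bound for \<open>d\<close> on \<open>K\<close>.\<close>

lemma metric_comparison_on_compact:
  assumes e: "Metric_space M e" and d: "Metric_space A d" and "A \<subseteq> M"
    and top: "subtopology (Metric_space.mtopology M e) A = Metric_space.mtopology A d"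
    and K: "compactin (Metric_space.mtopology A d) K" and "\<epsilon> > 0"
  obtains L where "1 \<le> L" "\<And>a b. \<lbrakk>a \<in> K; b \<in> K\<rbrakk> \<Longrightarrow> d a b \<le> \<epsilon> + L * e a b"
proof -
  interpret E: Metric_space M e by fact
  interpret A: Metric_space A d by fact
  have KA: "K \<subseteq> A" using compactin_subset_topspace[OF K] by simp
  interpret EK: Submetric M e K by unfold_locales (use KA assms(3) in auto)
  have topK: "EK.sub.mtopology = subtopology A.mtopology K"
    using KA by (simp add: EK.mtopology_submetric top[symmetric] subtopology_subtopology inf.absorb2)
  have "uniformly_continuous_map (metric (K, e)) (metric (A, d)) id"
    using K by (intro continuous_imp_uniformly_continuous_map)
      (auto simp: topK compact_space_subtopology intro: continuous_map_from_subtopology)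
  then obtain \<delta> where \<delta>: "\<delta> > 0" "\<And>a b. \<lbrakk>a \<in> K; b \<in> K; e b a < \<delta>\<rbrakk> \<Longrightarrow> d b a < \<epsilon>"
    using \<open>\<epsilon> > 0\<close> unfolding uniformly_continuous_map_def by auto
  obtain B where B: "\<And>a b. \<lbrakk>a \<in> K; b \<in> K\<rbrakk> \<Longrightarrow> d a b \<le> B"
    using A.compactin_imp_mbounded[OF K] unfolding A.mbounded_alt by blast
  have "d a b \<le> \<epsilon> + max 1 (B / \<delta>) * e a b" if ab: "a \<in> K" "b \<in> K" for a b
  proof (cases "e a b < \<delta>")
    case True
    have "0 \<le> max 1 (B / \<delta>) * e a b" by (intro mult_nonneg_nonneg) auto
    then show ?thesis using \<delta>(2)[OF ab(2,1) True] by linarith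
  next
    case False
    have "0 \<le> B" using B[OF ab] A.nonneg[of a b] by linarith
    then have "B \<le> B / \<delta> * e a b" using False \<delta>(1) by (simp add: field_simps mult_left_mono)
    also have "\<dots> \<le> max 1 (B / \<delta>) * e a b" by (rule mult_right_mono) auto
    finally show ?thesis using B[OF ab] \<open>\<epsilon> > 0\<close> by linarith
  qed
  then show ?thesis using that[of "max 1 (B / \<delta>)"] by simp
qed

section \<open>Assembly of the proper extension\<close>

theorem theorem3p9:
  fixes X :: "'a topology" and A :: "'a set" and d :: "'a \<Rightarrow> 'a \<Rightarrow> real"
  assumes "sigma_compact_space X"
    and "locally_compact_space X"
    and "Hausdorff_space X"
    and "metrizable_space X"
    and "closedin X A"
    and "A \<noteq> {}"
    and "d \<in> Met (subtopology X A)"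
    and "proper_metric A d"
  shows "\<exists>D. D \<in> Met X \<and> proper_metric (topspace X) D \<and> (\<forall>x\<in>A. \<forall>y\<in>A. D x y = d x y)"
proof -
  define M where "M = topspace X"
  have AM: "A \<subseteq> M" using closedin_subset[OF assms(5)] by (simp add: M_def)
  have "topspace (subtopology X A) = A" using AM by (auto simp: M_def)
  then have d: "Metric_space A d" and topA: "Metric_space.mtopology A d = subtopology X A"
    using assms(7) by (auto simp: Met_def)
  obtain M' e where e': "Metric_space M' e" "X = Metric_space.mtopology M' e"
    using assms(4) unfolding metrizable_space_def by blast
  have "M' = M" using e' Metric_space.topspace_mtopology M_def by metis
  then have e: "Metric_space M e" and topE: "Metric_space.mtopology M e = X" using e' by simp_all
  interpret A: Metric_space A d by fact
  interpret E: Metric_space M e by fact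
  obtain a0 where a0: "a0 \<in> A" using assms(6) by blast
  have "continuous_map A.mtopology euclideanreal (d a0)"
    using A.triangle A.commute a0 by (intro A.continuous_map_nonexpansive) (smt (verit))
  then have contd: "continuous_map (subtopology X A) euclideanreal (d a0)" by (simp add: topA)
  have compA: "compactin A.mtopology {a \<in> A. d a0 a \<le> r}" for r
  proof -
    have "{a \<in> A. d a0 a \<le> r} = A.mcball a0 r" using a0 by auto
    then show ?thesis
      using assms(8) A.closedin_mcball A.mbounded_mcball unfolding proper_metric_def by metis
  qed
  then have compX: "compactin X {a \<in> A. d a0 a \<le> r}" for r
    using compactin_subtopology topA by metis
  obtain p where p: "continuous_map X euclideanreal p" "\<And>r. compactin X {x \<in> M. p x \<le> r}"
    using E.proper_function_exists assms(1,2) unfolding topE by blast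
  obtain h where h: "continuous_map X euclideanreal h" "\<And>a. a \<in> A \<Longrightarrow> h a = d a0 a"
    "\<And>x. 0 \<le> h x" "\<And>r. compactin X {x \<in> topspace X. h x \<le> r}"
    using proper_extension_exists[OF metrizable_imp_normal_space[OF assms(4)] assms(5,6) contd _ compX p(1)]
      p(2) unfolding M_def by (metis A.nonneg)
  have dh: "d a b \<le> h a + h b" and hd: "\<bar>h a - h b\<bar> \<le> d a b" if "a \<in> A" "b \<in> A" for a b
    using A.triangle[OF that(1) a0 that(2)] A.triangle[OF a0 that] A.triangle[OF a0 that(2,1)]
      A.commute[of a a0] A.commute[of a b] h(2)[OF that(1)] h(2)[OF that(2)] by linarith+
  have "\<exists>L\<ge>1. \<forall>a\<in>A. \<forall>b\<in>A. h a \<le> k \<and> h b \<le> k \<longrightarrow> d a b \<le> 1 / Suc k + L * e a b" for k :: nat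
  proof -
    have "subtopology E.mtopology A = A.mtopology" by (simp add: topE topA)
    from metric_comparison_on_compact[OF e d AM this compA, of "1 / Suc k" k]
    obtain L where "1 \<le> L" "\<And>a b. \<lbrakk>a \<in> {a \<in> A. d a0 a \<le> k}; b \<in> {a \<in> A. d a0 a \<le> k}\<rbrakk> \<Longrightarrow> d a b \<le> 1 / Suc k + L * e a b"
      by auto
    then show ?thesis using h(2) by (intro exI[of _ L]) auto
  qed
  then obtain L where L: "\<And>k. 1 \<le> L k"
    "\<And>a b k. \<lbrakk>a \<in> A; b \<in> A; h a \<le> real k; h b \<le> real k\<rbrakk> \<Longrightarrow> d a b \<le> 1 / Suc k + L k * e a b"
    by metis
  obtain t where t: "Metric_space M t" "continuous_map X (Metric_space.mtopology M t) id"
    "\<And>x y. t x y \<le> 1"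
    "\<And>x y c. \<lbrakk>c \<le> 1; \<And>k. c \<le> 1 / Suc k + L k * e x y\<rbrakk> \<Longrightarrow> c \<le> t x y"
    using E.concave_gauge_metric[of L] L(1) unfolding topE by metis
  have dt: "d a b \<le> (1 + 2 * r * (r + 1)) * t a b"
    if ab: "a \<in> A" "b \<in> A" and r: "h a \<le> r" "h b \<le> r" for a b r
  proof -
    \<comment> \<open>Three lower bounds on \<open>C\<close> are used: \<open>2 * r\<close> for the
      cap 1, \<open>1\<close> for indices \<open>k\<close> with \<open>r \<le> k\<close>, where
      \<open>L\<close> controls \<open>d\<close> itself, and \<open>2 * r * (r + 1)\<close> for
      smaller \<open>k\<close>, where the intercept alone suffices.\<close>
    define C where "C = 1 + 2 * r * (r + 1)"
    have r0: "0 \<le> r" using h(3)[of a] r(1) by linarith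
    have C: "1 \<le> C" "2 * r \<le> C" "2 * r * (r + 1) \<le> C" using r0 by (auto simp: C_def algebra_simps)
    have d2r: "d a b \<le> 2 * r" using dh[OF ab] r by linarith
    have "d a b / C \<le> t a b"
    proof (rule t(4))
      show "d a b / C \<le> 1" using d2r C by (simp add: field_simps)
      fix k
      show "d a b / C \<le> 1 / Suc k + L k * e a b"
      proof (cases "r \<le> real k")
        case True
        have "d a b / C \<le> d a b" using C(1) A.nonneg[of a b] 
          using mult_right_mono[of 1 C "d a b"] by (simp add: field_simps)
        then show ?thesis using L(2)[OF ab, of k] r True by linarith
      next
        case False
        have "d a b / C \<le> 2 * r / C" using d2r C(1) by (simp add: divide_right_mono)
        also have "\<dots> \<le> 1 / (r + 1)" using C r0 by (simp add: field_simps)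
        also have "\<dots> \<le> 1 / Suc k" using False by (simp add: frac_le)
        finally have "d a b / C \<le> 1 / Suc k" .
        moreover have "0 \<le> L k * e a b" using L(1)[of k] by (intro mult_nonneg_nonneg) auto
        ultimately show ?thesis by linarith
      qed
    qed
    then show ?thesis using C(1) unfolding C_def[symmetric] by (simp add: field_simps)
  qed
  \<comment> \<open>\<open>w\<close> is the factor of \<open>dt\<close> at \<open>r = h x + 1\<close>.\<close>
  define w where "w x = 2 * (h x)\<^sup>2 + 6 * h x + 5" for x
  have w0: "0 < w x" for x using h(3)[of x] unfolding w_def by (intro add_nonneg_pos add_nonneg_nonneg) auto
  have contw: "continuous_map X euclideanreal w"
    unfolding w_def by (intro continuous_intros h(1)) auto
  \<comment> \<open>The slope of the quadratic \<open>w\<close> between two heights is at least 1,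
    which makes \<open>h\<close> 1-Lipschitz for \<open>s\<close>, and it exceeds the sum of the
    heights, which bounds \<open>d\<close>.\<close>
  have w_diff: "(2 * (h x + h y) + 6) * (h y - h x) = w y - w x" for x y
    by (simp add: w_def algebra_simps power2_eq_square)
  define s where "s x y = \<bar>w x - w y\<bar> + min (w x) (w y) * t x y" for x y
  have s: "Metric_space M s"
    using Metric_space.weighted_metric[OF t(1) w0 t(3)] unfolding s_def .
  have conts: "continuous_map X (Metric_space.mtopology M s) id"
    using continuous_weighted_metric[of X t w] t(1,2) s contw w0 unfolding s_def M_def by blast
  have t0: "0 \<le> t x y" for x y using Metric_space.nonneg[OF t(1)] .
  have ws: "\<bar>w x - w y\<bar> \<le> s x y" for x y
    using w0[of x] w0[of y] t0[of x y] by (auto simp: s_def)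
  have hs: "\<bar>h x - h y\<bar> \<le> s x y" for x y
  proof -
    have "1 * \<bar>h y - h x\<bar> \<le> (2 * (h x + h y) + 6) * \<bar>h y - h x\<bar>"
      using h(3)[of x] h(3)[of y] by (intro mult_right_mono) auto
    also have "\<dots> = \<bar>w y - w x\<bar>"
      using h(3)[of x] h(3)[of y] by (simp add: abs_mult flip: w_diff)
    finally show ?thesis using ws[of x y] by (simp add: abs_minus_commute)
  qed
  have ds': "d a b \<le> s a b" if ab: "a \<in> A" "b \<in> A" and le: "h a \<le> h b" for a b
  proof -
    have wle: "w a \<le> w b"
      using le h(3)[of a] unfolding w_def by (intro add_mono mult_left_mono power_mono) auto
    show ?thesis
    proof (cases "h b \<le> h a + 1")
      case True
      then have "d a b \<le> w a * t a b"
        using dt[OF ab, of "h a + 1"] by (simp add: w_def algebra_simps power2_eq_square)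
      then show ?thesis using wle by (simp add: s_def)
    next
      case False
      \<comment> \<open>For heights more than 1 apart, the weight difference alone exceeds
        \<open>h a + h b\<close>, the bound on \<open>d a b\<close> through
        \<open>a0\<close>.\<close>
      have "(2 * (h a + h b) + 6) * 1 \<le> (2 * (h a + h b) + 6) * (h b - h a)"
        using False h(3)[of a] h(3)[of b] by (intro mult_left_mono) auto
      then have "2 * (h a + h b) + 6 \<le> w b - w a" by (simp only: w_diff mult_1_right)
      moreover have "w b - w a \<le> s a b" using ws[of a b] by (simp add: abs_le_iff)
      moreover have "d a b \<le> 2 * (h a + h b) + 6" using dh[OF ab] h(3)[of a] h(3)[of b] by simp
      ultimately show ?thesis by (meson order_trans)
    qed
  qed
  have ds: "d a b \<le> s a b" if "a \<in> A" "b \<in> A" for a b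
    using ds'[OF that] ds'[OF that(2,1)] A.commute[of a b] Metric_space.commute[OF s, of a b] by (cases "h a \<le> h b") auto
  \<comment> \<open>The criterion is first applied to \<open>s\<close>, so that \<open>A\<close> is
    closed for \<open>s\<close>, as the gluing requires.\<close>
  have "Metric_space.mtopology M s = X"
    using proper_metric_topology(1)[of X s h] s conts h(4) hs unfolding M_def by blast
  then have "closedin (Metric_space.mtopology M s) A" using assms(5) by simp
  then obtain D where D: "Metric_space M D" "\<And>x y. D x y \<le> s x y"
    "\<And>a b. \<lbrakk>a \<in> A; b \<in> A\<rbrakk> \<Longrightarrow> D a b = d a b"
    "\<And>x y c. \<lbrakk>c \<le> s x y; \<And>a b. \<lbrakk>a \<in> A; b \<in> A\<rbrakk> \<Longrightarrow> c \<le> s x a + d a b + s b y\<rbrakk> \<Longrightarrow> c \<le> D x y"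
    using amalgamated_metric[OF s d assms(6) _ ds] by metis
  \<comment> \<open>Since \<open>D\<close> lies below \<open>s\<close>, the neighbourhoods that work
    for \<open>s\<close> work for \<open>D\<close>.\<close>
  have contD: "continuous_map X (Metric_space.mtopology M D) id"
    using conts D(2) le_less_trans
    unfolding Metric_space.continuous_map_id_to_metric[OF D(1) M_def[symmetric]]
      Metric_space.continuous_map_id_to_metric[OF s M_def[symmetric]] by meson
  \<comment> \<open>Along a detour each piece costs at least the change in \<open>h\<close>:
    \<open>hs\<close> covers the outer legs and \<open>hd\<close> the jump inside
    \<open>A\<close>.\<close>
  have hD: "\<bar>h x - h y\<bar> \<le> D x y" for x y
  proof (rule D(4)[OF hs])
    show "\<bar>h x - h y\<bar> \<le> s x a + d a b + s b y" if "a \<in> A" "b \<in> A" for a b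
      using hs[of x a] hd[OF that] hs[of b y] by linarith
  qed
  show ?thesis
    using proper_metric_topology[of X D h] D(1,3) contD h(4) hD unfolding M_def Met_def by blast
qed

end
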